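(* Let $(Z_t)_{t\in\mathbb Z}$ be i.i.d. real random variables with $\mathbb E Z_t=0$, $\mathbb E Z_t^2=1$. Let $a_j:[0,1]\to[0,\infty)$, $j\ge 0$, be functions for which there are constants $0<\rho,Q,M<\infty$, $0<\nu<1$ and a positive sequence $(\ell(j))_{j\ge 0}$ with $\sum_{j\ge1} j/\ell(j)<\infty$ such that $\inf_u a_0(u)>\rho$; $\sup_u a_j(u)\le Q/\ell(j)$ and $|a_j(u)-a_j(v)|\le M|u-v|/\ell(j)$ for all $j\ge0$ and all $u,v\in[0,1]$; and $Q\sum_{j\ge1}1/\ell(j)\le 1-\nu$. Let $\{X_{t,N}:t=1,\dots,N\}$ be the time-varying ARCH($\infty$) process with coefficients $a_j$ and, for $u_0\in(0,1]$, let $\{\tilde X_t(u_0)\}_{t\in\mathbb Z}$ be the associated stationary ARCH($\infty$) process at $u_0$. Then there exist a stationary, ergodic, positive process $\{U_t\}$, independent of (i.e. not depending on) $u_0$, with finite mean, and a constant $K$ independent of $t$ and $N$, such that $$|X_{t,N}^2-\tilde X_t(u_0)^2|\le K\left(\left|\frac tN-u_0\right|+\frac1N\right)U_t\qquad\text{almost surely.}$$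
   Context: The time-varying ARCH($\infty$) (tvARCH) process with coefficients $a_j$ satisfies $X_{t,N}=\sigma_{t,N}Z_t$, $\sigma_{t,N}^2=a_0(t/N)+\sum_{j\ge1}a_j(t/N)X_{t-j,N}^2$ for $t=1,\dots,N$; with the convention $a_j(u)=0$ for $u<0$ and $j\ge0$, its square is the almost surely unique causal solution, given by the time-varying Volterra series $$X_{t,N}^2=a_0\left(\tfrac tN\right)Z_t^2+\sum_{k\ge1}\sum_{j_1,\dots,j_k\ge1}a_0\left(\tfrac{t-\sum_{s=1}^kj_s}{N}\right)\prod_{r=1}^k a_{j_r}\left(\tfrac{t-\sum_{s=1}^{r-1}j_s}{N}\right)\prod_{r=0}^kZ^2_{t-\sum_{s=1}^rj_s}.$$ The stationary ARCH($\infty$) process at $u$ satisfies $\tilde X_t(u)=\sigma_t(u)Z_t$, $\sigma_t(u)^2=a_0(u)+\sum_{j\ge1}a_j(u)\tilde X_{t-j}(u)^2$ for all $t\in\mathbb Z$; its square is almost surely $$\tilde X_t(u)^2=a_0(u)Z_t^2+\sum_{k\ge1}\sum_{j_1,\dots,j_k\ge1}a_0(u)\prod_{r=1}^ka_{j_r}(u)\prod_{r=0}^kZ^2_{t-\sum_{s=1}^rj_s}.$$ *)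

theory Defs
  imports "HOL-Probability.Probability"
begin

definition iid_process :: "'w measure \<Rightarrow> (int \<Rightarrow> 'w \<Rightarrow> real) \<Rightarrow> bool" where
  "iid_process M Z \<longleftrightarrow>
     prob_space.indep_vars M (\<lambda>_. borel) Z UNIV \<and>
     (\<forall>s t. distr M borel (Z s) = distr M borel (Z t))"

text \<open>Laws are taken on the path space \<open>\<Pi>\<^sub>M t\<in>UNIV. borel\<close> of functions \<open>int \<Rightarrow> real\<close>.\<close>

definition stationary_process :: "'w measure \<Rightarrow> (int \<Rightarrow> 'w \<Rightarrow> real) \<Rightarrow> bool" where
  "stationary_process M U \<longleftrightarrow>
     (\<forall>t. U t \<in> borel_measurable M) \<and>
     distr M (\<Pi>\<^sub>M t\<in>UNIV. borel) (\<lambda>\<omega> t. U (t + 1) \<omega>) = distr M (\<Pi>\<^sub>M t\<in>UNIV. borel) (\<lambda>\<omega> t. U t \<omega>)"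

text \<open>To be read together with stationarity: every shift-invariant event of the path space has
  probability 0 or 1.\<close>

definition ergodic_process :: "'w measure \<Rightarrow> (int \<Rightarrow> 'w \<Rightarrow> real) \<Rightarrow> bool" where
  "ergodic_process M U \<longleftrightarrow>
     (\<forall>A \<in> sets (\<Pi>\<^sub>M t\<in>(UNIV :: int set). (borel :: real measure)).
        {x. (\<lambda>t. x (t + 1)) \<in> A} = A \<longrightarrow>
        measure M {\<omega> \<in> space M. (\<lambda>t. U t \<omega>) \<in> A} \<in> {0, 1})"

text \<open>In the two definitions below, \<open>b j s\<close> is the \<open>j\<close>-th coefficient in force at time \<open>s\<close>.
  The convergence of the series in the volatility equation is part of the equation.\<close>

definition arch_equations ::
  "'w measure \<Rightarrow> (int \<Rightarrow> 'w \<Rightarrow> real) \<Rightarrow> (nat \<Rightarrow> int \<Rightarrow> real) \<Rightarrow> int set \<Rightarrow> (int \<Rightarrow> 'w \<Rightarrow> real) \<Rightarrow> bool"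
where
  "arch_equations M Z b T X \<longleftrightarrow>
     (\<forall>t\<in>T. X t \<in> borel_measurable M) \<and>
     (\<exists>\<sigma>. (\<forall>t\<in>T. \<sigma> t \<in> borel_measurable M) \<and>
          (\<forall>t\<in>T. AE \<omega> in M. X t \<omega> = \<sigma> t \<omega> * Z t \<omega> \<and>
             ((\<lambda>j. b j t * (X (t - int j) \<omega>)\<^sup>2) has_sum ((\<sigma> t \<omega>)\<^sup>2 - b 0 t)) {1..}))"

text \<open>The summand of the Volterra series for the index tuple \<open>js = [j\<^sub>1, \<dots>, j\<^sub>k]\<close>. The tuples of
  all lengths \<open>k \<ge> 0\<close> with entries at least 1 are the lists in \<open>lists {1..}\<close>; the empty list
  accounts for the leading term \<open>b 0 t * (z t)\<^sup>2\<close>.\<close>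

definition volterra_term ::
  "(nat \<Rightarrow> int \<Rightarrow> real) \<Rightarrow> (int \<Rightarrow> real) \<Rightarrow> int \<Rightarrow> nat list \<Rightarrow> real"
where
  "volterra_term b z t js =
     b 0 (t - int (sum_list js)) *
     (\<Prod>r<length js. b (js ! r) (t - int (sum_list (take r js)))) *
     (\<Prod>r\<le>length js. (z (t - int (sum_list (take r js))))\<^sup>2)"

text \<open>The coefficients \<open>a\<^sub>j(t/N)\<close> under the convention \<open>a\<^sub>j(u) = 0\<close> for \<open>u < 0\<close>.\<close>

definition tv_coeff :: "(nat \<Rightarrow> real \<Rightarrow> real) \<Rightarrow> nat \<Rightarrow> nat \<Rightarrow> int \<Rightarrow> real" where
  "tv_coeff a N j t = (if t < 0 then 0 else a j (real_of_int t / real N))"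

text \<open>With this convention the equations are imposed at all times \<open>t \<le> N\<close>. At the times
  \<open>t \<le> 0\<close> they fix the presample values to be the ones of the Volterra series:
  \<open>(X t)\<^sup>2 = 0\<close> for \<open>t < 0\<close> and \<open>(X 0)\<^sup>2 = a 0 0 * (Z 0)\<^sup>2\<close>. The equations then determine the squares
  almost surely; see \<open>tvARCH_volterra\<close>.\<close>

definition tvARCH ::
  "'w measure \<Rightarrow> (int \<Rightarrow> 'w \<Rightarrow> real) \<Rightarrow> (nat \<Rightarrow> real \<Rightarrow> real) \<Rightarrow> nat \<Rightarrow> (int \<Rightarrow> 'w \<Rightarrow> real) \<Rightarrow> bool"
where
  "tvARCH M Z a N X \<longleftrightarrow> arch_equations M Z (tv_coeff a N) {..int N} X"

text \<open>The equations over all of \<open>int\<close> do not by themselves single out a solution; the stationary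
  process is the one whose square is given by the Volterra series.\<close>

definition stationary_ARCH ::
  "'w measure \<Rightarrow> (int \<Rightarrow> 'w \<Rightarrow> real) \<Rightarrow> (nat \<Rightarrow> real \<Rightarrow> real) \<Rightarrow> real \<Rightarrow> (int \<Rightarrow> 'w \<Rightarrow> real) \<Rightarrow> bool"
where
  "stationary_ARCH M Z a u X \<longleftrightarrow>
     arch_equations M Z (\<lambda>j _. a j u) UNIV X \<and>
     (\<forall>t. AE \<omega> in M.
        (volterra_term (\<lambda>j _. a j u) (\<lambda>s. Z s \<omega>) t has_sum (X t \<omega>)\<^sup>2) (lists {1..}))"

lemma volterra_term_Nil [simp]: "volterra_term b z t [] = b 0 t * (z t)\<^sup>2"
  by (simp add: volterra_term_def)

lemma volterra_term_Cons:
  "volterra_term b z t (j # js) = (z t)\<^sup>2 * b j t * volterra_term b z (t - int j) js"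
proof -
  have A: "(\<Prod>r<length (j # js). b ((j # js) ! r) (t - int (sum_list (take r (j # js))))) =
        b j t * (\<Prod>r<length js. b (js ! r) (t - int j - int (sum_list (take r js))))"
    by (simp add: prod.lessThan_Suc_shift algebra_simps del: prod.lessThan_Suc)
  have B: "(\<Prod>r\<le>length (j # js). (z (t - int (sum_list (take r (j # js)))))\<^sup>2) =
        (z t)\<^sup>2 * (\<Prod>r\<le>length js. (z (t - int j - int (sum_list (take r js))))\<^sup>2)"
    by (simp add: prod.atMost_Suc_shift algebra_simps del: prod.atMost_Suc)
  have C: "b 0 (t - int (sum_list (j # js))) = b 0 (t - int j - int (sum_list js))"
    by (simp add: algebra_simps)
  show ?thesis unfolding volterra_term_def A B C by (simp only: mult_ac)
qed

lemma has_sum_volterra_of_recursion: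
  fixes b :: "nat \<Rightarrow> int \<Rightarrow> real" and x z \<sigma> :: "int \<Rightarrow> real"
  assumes b0: "\<And>j s. s < 0 \<Longrightarrow> b j s = 0"
    and xz: "\<And>s. s \<le> n \<Longrightarrow> x s = \<sigma> s * z s"
    and \<sigma>: "\<And>s. s \<le> n \<Longrightarrow> ((\<lambda>j. b j s * (x (s - int j))\<^sup>2) has_sum ((\<sigma> s)\<^sup>2 - b 0 s)) {1..}"
    and "t \<le> n"
  shows "(volterra_term b z t has_sum (x t)\<^sup>2) (lists {1..})"
  using \<open>t \<le> n\<close>
proof (induction "nat (t + 1)" arbitrary: t rule: less_induct)
  case less
  have neg: "volterra_term b z s js = 0" if "s < 0" for s js
    using b0 that by (simp add: volterra_term_def)
  have xneg: "x s = 0" if "s < 0" "s \<le> n" for s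
  proof -
    have "((\<lambda>j. 0) has_sum ((\<sigma> s)\<^sup>2 - b 0 s)) {1::nat..}"
      using \<sigma>[OF that(2)] b0[OF that(1)] by simp
    then have "(\<sigma> s)\<^sup>2 - b 0 s = 0" by (metis has_sum_0_simp has_sum_unique)
    then show ?thesis using b0[OF that(1)] xz[OF that(2)] by simp
  qed
  define J where "J = {1..nat t}"
  have eq: "(\<sigma> t)\<^sup>2 = b 0 t + (\<Sum>j\<in>J. b j t * (x (t - int j))\<^sup>2)"
  proof -
    have "((\<lambda>j. b j t * (x (t - int j))\<^sup>2) has_sum ((\<sigma> t)\<^sup>2 - b 0 t)) J"
    proof (subst has_sum_cong_neutral)
      show "((\<lambda>j. b j t * (x (t - int j))\<^sup>2) has_sum ((\<sigma> t)\<^sup>2 - b 0 t)) {1..}"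
        using \<sigma>[OF less.prems] .
    next
      fix j assume "j \<in> {1..} - J"
      then have "t - int j < 0" "t - int j \<le> n" using less.prems by (auto simp: J_def)
      then show "b j t * (x (t - int j))\<^sup>2 = 0" by (simp add: xneg)
    qed (auto simp: J_def)
    then have "(\<sigma> t)\<^sup>2 - b 0 t = (\<Sum>j\<in>J. b j t * (x (t - int j))\<^sup>2)"
      by (metis J_def finite_atLeastAtMost has_sum_finite has_sum_unique)
    then show ?thesis by simp
  qed
  have part: "(volterra_term b z t has_sum (z t)\<^sup>2 * b j t * (x (t - int j))\<^sup>2) (Cons j ` lists {1..})"
    if "j \<in> J" for j
  proof -
    have "(volterra_term b z (t - int j) has_sum (x (t - int j))\<^sup>2) (lists {1..})"
      using that less.prems by (intro less.hyps) (auto simp: J_def)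
    from has_sum_cmult_right[OF this, of "(z t)\<^sup>2 * b j t"] show ?thesis
      by (subst has_sum_reindex) (auto simp: o_def volterra_term_Cons)
  qed
  have fin: "(volterra_term b z t has_sum (\<Sum>j\<in>F. (z t)\<^sup>2 * b j t * (x (t - int j))\<^sup>2))
      (\<Union>j\<in>F. Cons j ` lists {1..})" if "finite F" "F \<subseteq> J" for F
    using that
  proof (induction F rule: finite_induct)
    case (insert j F)
    then show ?case
      using has_sum_Un_disjoint[OF part[of j] insert.IH] by auto
  qed simp
  have "(volterra_term b z t has_sum
      (\<Sum>j\<in>J. (z t)\<^sup>2 * b j t * (x (t - int j))\<^sup>2) + b 0 t * (z t)\<^sup>2)
      ((\<Union>j\<in>J. Cons j ` lists {1..}) \<union> {[]})"
    by (intro has_sum_Un_disjoint fin has_sum_finiteI) (auto simp: J_def)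
  also have "(\<Sum>j\<in>J. (z t)\<^sup>2 * b j t * (x (t - int j))\<^sup>2) + b 0 t * (z t)\<^sup>2 = (x t)\<^sup>2"
    by (simp add: xz[OF less.prems] power_mult_distrib eq sum_distrib_left algebra_simps)
  finally show ?case
  proof (subst has_sum_cong_neutral)
    fix js assume js: "js \<in> lists {1..} - ((\<Union>j\<in>J. Cons j ` lists {1..}) \<union> {[]})"
    then obtain j js' where "js = j # js'" "js' \<in> lists {1..}" "1 \<le> j"
      by (cases js) auto
    with js have "t - int j < 0" by (auto simp: J_def)
    then show "volterra_term b z t js = 0"
      using \<open>js = j # js'\<close> by (simp add: volterra_term_Cons neg)
  qed (auto simp: J_def)
qed

lemma tvARCH_volterra:
  assumes "tvARCH M Z a N X" "t \<le> int N"
  shows "AE \<omega> in M.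
    (volterra_term (tv_coeff a N) (\<lambda>s. Z s \<omega>) t has_sum (X t \<omega>)\<^sup>2) (lists {1..})"
proof -
  obtain \<sigma> where *: "\<forall>s\<in>{..int N}. AE \<omega> in M. X s \<omega> = \<sigma> s \<omega> * Z s \<omega> \<and>
      ((\<lambda>j. tv_coeff a N j s * (X (s - int j) \<omega>)\<^sup>2) has_sum
        ((\<sigma> s \<omega>)\<^sup>2 - tv_coeff a N 0 s)) {1..}"
    using assms(1) unfolding tvARCH_def arch_equations_def by blast
  have "AE \<omega> in M. \<forall>s\<in>{..int N}. X s \<omega> = \<sigma> s \<omega> * Z s \<omega> \<and>
      ((\<lambda>j. tv_coeff a N j s * (X (s - int j) \<omega>)\<^sup>2) has_sum
        ((\<sigma> s \<omega>)\<^sup>2 - tv_coeff a N 0 s)) {1..}"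
    using * by (subst AE_ball_countable) auto
  then show ?thesis
  proof (rule AE_mp, intro AE_I2 impI)
    fix \<omega>
    assume H: "\<forall>s\<in>{..int N}. X s \<omega> = \<sigma> s \<omega> * Z s \<omega> \<and>
      ((\<lambda>j. tv_coeff a N j s * (X (s - int j) \<omega>)\<^sup>2) has_sum
        ((\<sigma> s \<omega>)\<^sup>2 - tv_coeff a N 0 s)) {1..}"
    show "(volterra_term (tv_coeff a N) (\<lambda>s. Z s \<omega>) t has_sum (X t \<omega>)\<^sup>2) (lists {1..})"
    proof (rule has_sum_volterra_of_recursion[where n = "int N" and \<sigma> = "\<lambda>s. \<sigma> s \<omega>"])
      show "tv_coeff a N j s = 0" if "s < 0" for j s
        using that by (simp add: tv_coeff_def)
    qed (use H assms(2) in blast)+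
  qed
qed

end

theory Submission
  imports Defs
begin

text \<open>
  Both squared processes are sums over the same index tuples \<open>js = [j\<^sub>1, \<dots>, j\<^sub>k]\<close> of products of
  \<open>k + 1\<close> coefficients and \<open>k + 1\<close> squared innovations; only the coefficients differ. Every
  coefficient with index \<open>j\<close> is bounded by \<open>B j = Q / l j\<close> and has a Lipschitz constant proportional
  to \<open>B j\<close>. Exchanging coefficients one at a time therefore bounds the difference of the two terms
  for \<open>js\<close> by a constant times \<open>\<bar>t / N - u0\<bar> + 1 / N\<close> times
  \<open>(k + 1) * (1 + j\<^sub>1 + \<dots> + j\<^sub>k)\<close> times the term with all coefficients replaced by their bounds
  (\<open>volterra_term_tv_diff_le\<close>). The sum of these weighted terms, plus \<open>1\<close>, is \<open>U t\<close>.

  The process \<open>U\<close> has finite mean: the squared innovations in a term sit at distinct times, so the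
  term has mean \<open>B 0 * B j\<^sub>1 * \<dots> * B j\<^sub>k\<close>, and the weighted sum of these products converges since
  \<open>(\<Sum>j\<ge>1. B j) < 1\<close> and \<open>(\<Sum>j\<ge>1. j * B j) < \<infinity>\<close> (\<open>list_weight_summable\<close>, \<open>integrable_majorant\<close>).

  The value \<open>U t\<close> is a fixed measurable function of the innovations shifted by \<open>t\<close>. A process of this
  form is stationary, and it is ergodic because the Bernoulli shift is
  (\<open>factor_of_iid_stationary_ergodic\<close>). For the latter, a shift-invariant event is shown to be
  uncorrelated with every cylinder by a second-moment estimate for sums over far translates of the
  cylinder; it is then independent of itself.
\<close>

section \<open>Ergodicity of factors of i.i.d. processes\<close>

lemma measurable_shift:
  "(\<lambda>x t. x (t + n)) \<in> measurable (\<Pi>\<^sub>M t\<in>UNIV. N) (\<Pi>\<^sub>M t\<in>(UNIV :: int set). N)"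
  by (rule measurable_abs_UNIV) simp

lemma distr_PiM_shift:
  fixes n :: int
  assumes "prob_space N"
  shows "distr (\<Pi>\<^sub>M t\<in>UNIV. N) (\<Pi>\<^sub>M t\<in>UNIV. N) (\<lambda>x t. x (t + n)) = (\<Pi>\<^sub>M t\<in>UNIV. N)"
  using distr_PiM_reindex[of UNIV "\<lambda>_. N" "\<lambda>t. t + n" UNIV] assms
  by (simp add: inj_on_def restrict_def)

lemma (in prob_space) square_expectation_le:
  fixes f :: "'a \<Rightarrow> real"
  assumes "integrable M f" "integrable M (\<lambda>x. (f x)\<^sup>2)"
  shows "(expectation f)\<^sup>2 \<le> expectation (\<lambda>x. (f x)\<^sup>2)"
  using variance_positive[of f] variance_eq[OF assms] by simp

text \<open>Let \<open>D\<close> be the cylinder, of probability \<open>p\<close>, and translate it by multiples \<open>m * i\<close> of a step \<open>m\<close>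
  so large that the translates \<open>D (m * i)\<close> depend on disjoint sets of coordinates. Since \<open>A\<close> and the
  measure are shift-invariant, all translates have the same covariance \<open>c\<close> with \<open>A\<close>. Hence
  \<open>n * c\<close> is the integral over \<open>A\<close> of \<open>Y = (\<Sum>i<n. indicator (D (m * i)) - p)\<close>, a sum of \<open>n\<close>
  pairwise uncorrelated centred terms, whose second moment is at most \<open>n\<close>. So
  \<open>n\<^sup>2 * c\<^sup>2 \<le> n\<close> for every \<open>n\<close>, which forces \<open>c = 0\<close>.\<close>

lemma shift_invariant_event_independent_of_cylinder:
  fixes N :: "'a measure" and A :: "(int \<Rightarrow> 'a) set"
  defines "P \<equiv> \<Pi>\<^sub>M t\<in>UNIV. N"
  assumes N: "prob_space N"
    and A [measurable]: "A \<in> sets P"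
    and inv: "{x \<in> space P. (\<lambda>t. x (t + 1)) \<in> A} = A"
    and J: "finite J" and E: "\<And>j. j \<in> J \<Longrightarrow> E j \<in> sets N"
  shows "measure P (A \<inter> {x \<in> space P. \<forall>j\<in>J. x j \<in> E j}) =
    measure P A * measure P {x \<in> space P. \<forall>j\<in>J. x j \<in> E j}"
proof -
  interpret product_prob_space "\<lambda>_. N" "UNIV :: int set"
    by (rule product_prob_spaceI) (rule N)
  interpret prob_space P
    unfolding P_def by (intro prob_space_PiM N)
  have shift [measurable]: "(\<lambda>x t. x (t + n)) \<in> measurable P P" for n
    unfolding P_def by (rule measurable_shift)
  have shift_space: "(\<lambda>t. x (t + n)) \<in> space P \<longleftrightarrow> x \<in> space P" for x n
  proof
    assume "(\<lambda>t. x (t + n)) \<in> space P"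
    then have "x ((t - n) + n) \<in> space N" for t
      unfolding P_def space_PiM PiE_UNIV_domain by blast
    then show "x \<in> space P" by (simp add: P_def space_PiM PiE_UNIV_domain)
  qed (auto simp: P_def space_PiM)
  have inv': "(\<lambda>t. x (t + int n)) \<in> A \<longleftrightarrow> x \<in> A" if "x \<in> space P" for x n
    using that
  proof (induction n arbitrary: x)
    case (Suc n)
    have "(\<lambda>t. x (t + int (Suc n))) = (\<lambda>t. (\<lambda>s. x (s + 1)) (t + int n))"
      by (simp add: algebra_simps)
    then have "(\<lambda>t. x (t + int (Suc n))) \<in> A \<longleftrightarrow> (\<lambda>s. x (s + 1)) \<in> A"
      using Suc.IH[of "\<lambda>s. x (s + 1)"] Suc.prems by (simp add: shift_space)
    then show ?case using inv Suc.prems by blast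
  qed simp
  define D where "D n = {x \<in> space P. \<forall>j\<in>J. x (j + n) \<in> E j}" for n
  define p where "p = prob (D 0)"
  have cylinder: "{x \<in> space P. \<forall>s\<in>S. x s \<in> G s} = prod_emb UNIV (\<lambda>_. N) S (\<Pi>\<^sub>E s\<in>S. G s)" for S G
    by (auto simp: P_def prod_emb_def space_PiM PiE_iff)
  have emb: "D n = prod_emb UNIV (\<lambda>_. N) ((\<lambda>j. j + n) ` J) (\<Pi>\<^sub>E i\<in>(\<lambda>j. j + n) ` J. E (i - n))" for n
    unfolding D_def cylinder[symmetric] by simp
  have D [measurable]: "D n \<in> sets P" for n
    unfolding emb P_def using J E by (intro sets_PiM_I) auto
  have prod_p: "prob (D n) = (\<Prod>j\<in>J. measure N (E j))" for n
    unfolding emb P_def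
    by (subst measure_PiM_emb) (use J E in \<open>auto simp: prod.reindex inj_on_def\<close>)
  then have p: "prob (D n) = p" for n by (simp add: p_def)
  have D_shift: "D n = {x \<in> space P. (\<lambda>t. x (t + n)) \<in> D 0}" for n
    by (auto simp: D_def shift_space)
  have AD: "prob (A \<inter> D (int n)) = prob (A \<inter> D 0)" for n
  proof -
    have "prob (A \<inter> D 0) = measure (distr P P (\<lambda>x t. x (t + int n))) (A \<inter> D 0)"
      using distr_PiM_shift[OF N] by (simp add: P_def)
    also have "\<dots> = prob ((\<lambda>x t. x (t + int n)) -` (A \<inter> D 0) \<inter> space P)"
      by (intro measure_distr) auto
    also have "(\<lambda>x t. x (t + int n)) -` (A \<inter> D 0) \<inter> space P = A \<inter> D (int n)"
      unfolding D_shift[of "int n"] using inv' sets.sets_into_space[OF A] by auto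
    finally show ?thesis ..
  qed
  \<comment> \<open>Two coordinates in \<open>J\<close> differ by less than \<open>m\<close>, so translates by distinct multiples of \<open>m\<close> are disjoint.\<close>
  define m where "m = nat (2 * (\<Sum>j\<in>J. \<bar>j\<bar>) + 1)"
  have far: "(\<lambda>j. j + int (m * i)) ` J \<inter> (\<lambda>j. j + int (m * k)) ` J = {}" if "i \<noteq> k" for i k
  proof -
    have le: "\<bar>j\<bar> \<le> (\<Sum>j\<in>J. \<bar>j\<bar>)" if "j \<in> J" for j
      using J that by (intro member_le_sum) auto
    have m: "int m = 2 * (\<Sum>j\<in>J. \<bar>j\<bar>) + 1"
      unfolding m_def by (simp add: sum_nonneg)
    have False if "j \<in> J" "j' \<in> J" "j + int (m * i) = j' + int (m * k)" for j j'
    proof -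
      have "j - j' = int m * (int k - int i)"
        using that(3) by (simp add: algebra_simps)
      then have "\<bar>j - j'\<bar> = int m * \<bar>int k - int i\<bar>"
        by (simp add: abs_mult)
      moreover have "int m * 1 \<le> int m * \<bar>int k - int i\<bar>"
        using \<open>i \<noteq> k\<close> by (intro mult_left_mono) auto
      ultimately show False using le[OF that(1)] le[OF that(2)] m by linarith
    qed
    then show ?thesis by auto
  qed
  have DD: "prob (D (int (m * i)) \<inter> D (int (m * k))) = p * p" if "i \<noteq> k" for i k
  proof -
    define S where "S i = (\<lambda>j. j + int (m * i)) ` J" for i
    define G where "G s = (if s \<in> S i then E (s - int (m * i)) else E (s - int (m * k)))" for s
    have disj: "S i \<inter> S k = {}" using far[OF that] by (simp add: S_def)
    have G_i: "G (j + int (m * i)) = E j" if "j \<in> J" for j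
      using that by (simp add: G_def S_def)
    have G_k: "G (j + int (m * k)) = E j" if "j \<in> J" for j
    proof -
      have "j + int (m * k) \<in> S k" using that by (simp add: S_def)
      then have "j + int (m * k) \<notin> S i" using disj by blast
      then show ?thesis by (simp add: G_def)
    qed
    have "D (int (m * i)) \<inter> D (int (m * k)) = {x \<in> space P. \<forall>s\<in>S i \<union> S k. x s \<in> G s}"
      using G_i G_k by (auto simp: D_def S_def ball_Un simp del: of_nat_mult)
    also have "prob \<dots> = (\<Prod>s\<in>S i \<union> S k. measure N (G s))"
      unfolding cylinder unfolding P_def
      by (subst measure_PiM_emb) (use J E G_i G_k in \<open>auto simp: S_def simp del: of_nat_mult\<close>)
    also have "\<dots> = (\<Prod>s\<in>S i. measure N (G s)) * (\<Prod>s\<in>S k. measure N (G s))"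
      using J disj by (intro prod.union_disjoint) (auto simp: S_def)
    also have "(\<Prod>s\<in>S i. measure N (G s)) = (\<Prod>j\<in>J. measure N (E j))"
      unfolding S_def by (subst prod.reindex) (auto simp: inj_on_def G_i simp del: of_nat_mult)
    also have "(\<Prod>s\<in>S k. measure N (G s)) = (\<Prod>j\<in>J. measure N (E j))"
      unfolding S_def by (subst prod.reindex) (auto simp: inj_on_def G_k simp del: of_nat_mult)
    finally show ?thesis using prod_p p by simp
  qed
  define c where "c = prob (A \<inter> D 0) - prob A * p"
  have bound: "(real n * c)\<^sup>2 \<le> real n" for n
  proof -
    define f where "f i x = indicator (D (int (m * i))) x - p" for i :: nat and x
    define Y where "Y x = (\<Sum>i<n. f i x)" for x
    have [measurable]: "f i \<in> borel_measurable P" for i unfolding f_def by measurable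
    have [measurable]: "Y \<in> borel_measurable P" unfolding Y_def by measurable
    have p01: "0 \<le> p" "p \<le> 1" by (auto simp: p_def)
    have f1: "\<bar>f i x\<bar> \<le> 1" for i x
      using p01 by (auto simp: f_def indicator_def)
    have int_f: "integrable P (f i)" for i
      by (rule integrable_const_bound[where B = 1]) (use f1 in auto)
    have int_ff: "integrable P (\<lambda>x. f i x * f k x)" for i k
      by (rule integrable_const_bound[where B = 1])
        (use f1 in \<open>auto simp: abs_mult intro!: mult_le_one\<close>)
    have Y2: "(Y x)\<^sup>2 = (\<Sum>i<n. \<Sum>k<n. f i x * f k x)" for x
      by (simp add: Y_def power2_eq_square sum_product)
    have int_Y2: "integrable P (\<lambda>x. (Y x)\<^sup>2)"
      unfolding Y2 by (intro Bochner_Integration.integrable_sum int_ff)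
    have int_Y: "integrable P Y"
      unfolding Y_def by (intro Bochner_Integration.integrable_sum int_f)
    have ff: "expectation (\<lambda>x. f i x * f k x) = (if i = k then p - p * p else 0)" for i k
    proof -
      let ?I = "\<lambda>i x. indicator (D (int (m * i))) x :: real"
      have "(\<lambda>x. f i x * f k x) =
          (\<lambda>x. indicator (D (int (m * i)) \<inter> D (int (m * k))) x - p * ?I i x - p * ?I k x + p * p)"
        by (auto simp: f_def indicator_def algebra_simps fun_eq_iff)
      then have "expectation (\<lambda>x. f i x * f k x) =
          prob (D (int (m * i)) \<inter> D (int (m * k))) - p * p - p * p + p * p"
        by (simp add: p prob_space emeasure_eq_measure)
      then show ?thesis using DD p by simp
    qed
    have "expectation (\<lambda>x. (Y x)\<^sup>2) = (\<Sum>i<n. \<Sum>k<n. if i = k then p - p * p else 0)"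
      unfolding Y2 by (simp add: int_ff ff Bochner_Integration.integrable_sum)
    also have "\<dots> = real n * (p - p * p)" by simp
    also have "\<dots> \<le> real n * 1"
      using p01 by (intro mult_left_mono) (auto intro: order_trans[of _ p])
    finally have EY2: "expectation (\<lambda>x. (Y x)\<^sup>2) \<le> real n" by simp
    have "expectation (\<lambda>x. indicator A x * f i x) = c" for i
    proof -
      have "(\<lambda>x. indicator A x * f i x) =
          (\<lambda>x. indicator (A \<inter> D (int (m * i))) x - p * indicator A x)"
        by (auto simp: f_def indicator_def fun_eq_iff)
      then have "expectation (\<lambda>x. indicator A x * f i x) = prob (A \<inter> D (int (m * i))) - p * prob A"
        by (simp add: emeasure_eq_measure)
      then show ?thesis by (simp only: AD c_def mult.commute)
    qed
    moreover have "integrable P (\<lambda>x. indicator A x * f i x)" for i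
      using integrable_real_mult_indicator[OF A int_f] by (simp add: mult.commute)
    ultimately have "expectation (\<lambda>x. indicator A x * Y x) = real n * c"
      unfolding Y_def sum_distrib_left by (subst Bochner_Integration.integral_sum) simp_all
    moreover have int_AY: "integrable P (\<lambda>x. indicator A x * Y x)"
      using integrable_real_mult_indicator[OF A int_Y] by (simp add: mult.commute)
    have sq: "(indicator A x * Y x)\<^sup>2 = (Y x)\<^sup>2 * indicator A x" for x
      by (auto simp: indicator_def)
    have int_AY2: "integrable P (\<lambda>x. (indicator A x * Y x)\<^sup>2)"
      unfolding sq by (rule integrable_real_mult_indicator[OF A int_Y2])
    ultimately have "(real n * c)\<^sup>2 \<le> expectation (\<lambda>x. (indicator A x * Y x)\<^sup>2)"
      using square_expectation_le[OF int_AY int_AY2] by simp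
    also have "\<dots> \<le> expectation (\<lambda>x. (Y x)\<^sup>2)"
      by (intro integral_mono int_AY2 int_Y2) (auto simp: sq indicator_def)
    finally show ?thesis using EY2 by simp
  qed
  \<comment> \<open>Otherwise \<open>n * c\<^sup>2\<close> exceeds \<open>1\<close> for large \<open>n\<close>, against \<open>n\<^sup>2 * c\<^sup>2 \<le> n\<close>.\<close>
  have "c = 0"
  proof (rule ccontr)
    assume "c \<noteq> 0"
    then obtain n where n: "1 / c\<^sup>2 < real n" using reals_Archimedean2 by blast
    then have "0 < real n" using \<open>c \<noteq> 0\<close>
      by (smt (verit) divide_nonneg_nonneg zero_le_power2)
    moreover have "1 < real n * c\<^sup>2"
      using n \<open>c \<noteq> 0\<close> by (simp add: divide_simps)
    ultimately have "real n * 1 < real n * (real n * c\<^sup>2)" by (intro mult_strict_left_mono)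
    then show False using bound[of n] by (simp add: power2_eq_square mult_ac)
  qed
  then show ?thesis by (simp add: c_def p_def D_def)
qed

text \<open>Ergodicity of the Bernoulli shift. Independence passes from the cylinders, an intersection-stable
  generator, to every measurable event, so a shift-invariant \<open>A\<close> is independent of itself.\<close>

lemma shift_invariant_event_trivial:
  fixes N :: "'a measure" and A :: "(int \<Rightarrow> 'a) set"
  defines "P \<equiv> \<Pi>\<^sub>M t\<in>UNIV. N"
  assumes N: "prob_space N"
    and A: "A \<in> sets P"
    and inv: "{x \<in> space P. (\<lambda>t. x (t + 1)) \<in> A} = A"
  shows "measure P A \<in> {0, 1}"
proof -
  interpret prob_space P
    unfolding P_def by (intro prob_space_PiM N)
  let ?G = "prod_algebra UNIV (\<lambda>_ :: int. N)"
  have sets_P: "sets P = sigma_sets (space P) ?G"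
    by (simp add: P_def sets_PiM space_PiM)
  have G: "?G \<subseteq> events"
    by (auto simp: sets_P)
  have "indep_set {A} ?G"
  proof (rule indep_setI)
    fix B D assume "B \<in> {A}" "D \<in> ?G"
    then obtain J E where "B = A" "D = prod_emb UNIV (\<lambda>_. N) J (\<Pi>\<^sub>E j\<in>J. E j)"
      "finite J" "\<And>j. j \<in> J \<Longrightarrow> E j \<in> sets N"
      by (auto elim!: prod_algebraE)
    moreover from this have D: "D = {x \<in> space P. \<forall>j\<in>J. x j \<in> E j}"
      by (auto simp: P_def prod_emb_def space_PiM PiE_iff)
    ultimately show "prob (B \<inter> D) = prob B * prob D"
      unfolding D using shift_invariant_event_independent_of_cylinder[OF N, folded P_def, OF A inv]
      by blast
  qed (use A G in auto)
  then have "indep_set (sigma_sets (space P) {A}) (sigma_sets (space P) ?G)"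
    by (rule indep_set_sigma_sets) (auto simp: Int_stable_def Int_stable_prod_algebra[unfolded Int_stable_def])
  then have "prob (A \<inter> A) = prob A * prob A"
    by (rule indep_setD) (use A in \<open>auto simp: sets_P\<close>)
  then show ?thesis by simp
qed

text \<open>The path of the process \<open>U t = g (\<lambda>s. Z (s + t))\<close> is the image of the path of \<open>Z\<close>
  under a measurable map \<open>F\<close> that commutes with the shift. The law of \<open>Z\<close> is shift-invariant, hence
  so is its image under \<open>F\<close>; and the preimage under \<open>F\<close> of a shift-invariant event is shift-invariant,
  hence trivial.\<close>

lemma factor_of_iid_stationary_ergodic:
  fixes Z :: "int \<Rightarrow> 'w \<Rightarrow> real" and g :: "(int \<Rightarrow> real) \<Rightarrow> real"
  assumes M: "prob_space M" and Z: "iid_process M Z"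
    and g [measurable]: "g \<in> borel_measurable (\<Pi>\<^sub>M t\<in>UNIV. borel)"
  shows "stationary_process M (\<lambda>t \<omega>. g (\<lambda>s. Z (s + t) \<omega>))"
    and "ergodic_process M (\<lambda>t \<omega>. g (\<lambda>s. Z (s + t) \<omega>))"
proof -
  interpret prob_space M by (rule M)
  let ?B = "\<Pi>\<^sub>M t\<in>(UNIV :: int set). (borel :: real measure)"
  define N where "N = distr M borel (Z 0)"
  define P where "P = (\<Pi>\<^sub>M t\<in>(UNIV :: int set). N)"
  have Z_meas [measurable]: "Z t \<in> borel_measurable M" for t
    using Z by (auto simp: iid_process_def indep_vars_def)
  have N: "prob_space N" unfolding N_def by (rule prob_space_distr) simp
  have sets_P [measurable_cong]: "sets P = sets ?B"
    unfolding P_def N_def by (intro sets_PiM_cong) auto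
  have space_P: "space P = UNIV" "space ?B = UNIV"
    by (auto simp: P_def N_def space_PiM)
  have path [measurable]: "(\<lambda>\<omega> t. Z t \<omega>) \<in> measurable M ?B"
    by (rule measurable_abs_UNIV) simp
  have law: "distr M ?B (\<lambda>\<omega> t. Z t \<omega>) = P"
  proof -
    have "distr M ?B (\<lambda>\<omega>. \<lambda>t\<in>UNIV. Z t \<omega>) = (\<Pi>\<^sub>M t\<in>UNIV. distr M borel (Z t))"
      using Z by (subst indep_vars_iff_distr_eq_PiM[symmetric]) (auto simp: iid_process_def)
    also have "\<dots> = P"
      using Z unfolding P_def N_def iid_process_def by (intro PiM_cong) auto
    finally show ?thesis by (simp add: restrict_def)
  qed
  have shift [measurable]: "(\<lambda>x t. x (t + n)) \<in> measurable ?B ?B" for n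
    by (rule measurable_shift)
  define F where "F x t = g (\<lambda>s. x (s + t))" for x and t :: int
  have F [measurable]: "F \<in> measurable ?B ?B"
    unfolding F_def
    by (rule measurable_abs_UNIV) (rule measurable_compose[OF shift g])
  have F_shift: "F (\<lambda>t. x (t + 1)) = (\<lambda>t. F x (t + 1))" for x
    by (rule ext) (simp add: F_def algebra_simps)
  have shift_P: "distr P ?B (\<lambda>x t. x (t + 1)) = P"
    using distr_PiM_shift[OF N, of 1] by (simp add: P_def[symmetric] sets_P cong: distr_cong)
  have "(\<lambda>\<omega> t. F (\<lambda>t. Z t \<omega>) (t + 1)) = (\<lambda>\<omega>. F (\<lambda>t. Z (t + 1) \<omega>))"
    using F_shift[of "\<lambda>t. Z t _"] by (simp add: fun_eq_iff)
  then have "distr M ?B (\<lambda>\<omega> t. F (\<lambda>t. Z t \<omega>) (t + 1)) =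
      distr (distr (distr M ?B (\<lambda>\<omega> t. Z t \<omega>)) ?B (\<lambda>x t. x (t + 1))) ?B F"
    by (simp add: distr_distr comp_def)
  also have "\<dots> = distr (distr M ?B (\<lambda>\<omega> t. Z t \<omega>)) ?B F"
    by (simp only: law shift_P)
  also have "\<dots> = distr M ?B (\<lambda>\<omega>. F (\<lambda>t. Z t \<omega>))"
    by (simp add: distr_distr comp_def)
  finally have same_law: "distr M ?B (\<lambda>\<omega> t. F (\<lambda>t. Z t \<omega>) (t + 1)) =
      distr M ?B (\<lambda>\<omega>. F (\<lambda>t. Z t \<omega>))" .
  have "(\<lambda>\<omega>. g (\<lambda>s. Z (s + t) \<omega>)) \<in> borel_measurable M" for t
    using measurable_compose[OF measurable_compose[OF path shift[of t]] g] by simp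
  then show "stationary_process M (\<lambda>t \<omega>. g (\<lambda>s. Z (s + t) \<omega>))"
    using same_law unfolding stationary_process_def F_def by blast
  show "ergodic_process M (\<lambda>t \<omega>. g (\<lambda>s. Z (s + t) \<omega>))"
    unfolding ergodic_process_def
  proof (intro ballI impI)
    fix A assume A [measurable]: "A \<in> sets ?B" and inv: "{x. (\<lambda>t. x (t + 1)) \<in> A} = A"
    define A' where "A' = F -` A"
    have A' [measurable]: "A' \<in> sets ?B"
      using measurable_sets[OF F A] by (simp add: A'_def space_P)
    have "{x \<in> space P. (\<lambda>t. x (t + 1)) \<in> A'} = A'"
      using inv by (auto simp: A'_def F_shift space_P)
    then have "measure P A' \<in> {0, 1}"
      using shift_invariant_event_trivial[OF N, folded P_def, of A'] A' by (simp add: sets_P)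
    also have "measure P A' = measure M ((\<lambda>\<omega> t. Z t \<omega>) -` A' \<inter> space M)"
      unfolding law[symmetric] by (intro measure_distr) auto
    also have "(\<lambda>\<omega> t. Z t \<omega>) -` A' \<inter> space M = {\<omega> \<in> space M. (\<lambda>t. g (\<lambda>s. Z (s + t) \<omega>)) \<in> A}"
      by (auto simp: A'_def F_def[abs_def])
    finally show "measure M {\<omega> \<in> space M. (\<lambda>t. g (\<lambda>s. Z (s + t) \<omega>)) \<in> A} \<in> {0, 1}" .
  qed
qed

section \<open>Sums over index tuples\<close>

lemma has_sum_mult_Times_nonneg:
  fixes f g :: "_ \<Rightarrow> real"
  assumes f: "(f has_sum a) A" and g: "(g has_sum b) B"
    and "\<And>x. x \<in> A \<Longrightarrow> 0 \<le> f x" "\<And>y. y \<in> B \<Longrightarrow> 0 \<le> g y"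
  shows "((\<lambda>(x, y). f x * g y) has_sum a * b) (A \<times> B)"
proof -
  have inner: "((\<lambda>y. case (x, y) of (x, y) \<Rightarrow> f x * g y) has_sum f x * b) B" for x
    using has_sum_cmult_right[OF g] by simp
  have outer: "((\<lambda>x. f x * b) has_sum a * b) A"
    using has_sum_cmult_left[OF f] by simp
  show ?thesis
    by (rule has_sum_SigmaI[OF inner outer], rule summable_on_SigmaI[OF inner])
      (use assms(3,4) has_sum_imp_summable[OF outer] in auto)
qed

lemma has_sum_lists_Suc:
  fixes f :: "nat list \<Rightarrow> real"
  assumes "((\<lambda>(j, js). f (j # js)) has_sum s) (A \<times> {js \<in> lists A. length js = k})"
  shows "(f has_sum s) {js \<in> lists A. length js = Suc k}"
proof -
  have "{js \<in> lists A. length js = Suc k} =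
      (\<lambda>(j, js). j # js) ` (A \<times> {js \<in> lists A. length js = k})"
    by (auto simp: length_Suc_conv image_iff)
  moreover have "inj_on (\<lambda>(j, js). j # js) X" for X :: "(nat \<times> nat list) set"
    by (auto simp: inj_on_def)
  ultimately show ?thesis
    using assms by (simp add: has_sum_reindex comp_def case_prod_unfold)
qed

text \<open>The next two facts are moments of a tuple with \<open>k\<close> independent entries, each of (unnormalised)
  mass function \<open>B\<close> with total mass \<open>q\<close> and first moment \<open>\<mu>\<close>: the total mass, and the integral
  of the sum of the entries. Both follow by induction on \<open>k\<close>, splitting off the first entry.\<close>

lemma has_sum_lists_prod_list:
  fixes B :: "nat \<Rightarrow> real"
  assumes q: "(B has_sum q) A" and B: "\<And>j. 0 \<le> B j"
  shows "((\<lambda>js. prod_list (map B js)) has_sum q ^ k) {js \<in> lists A. length js = k}"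
proof (induction k)
  case 0
  have "{js \<in> lists A. length js = 0} = {[]}" by auto
  then show ?case by (simp add: has_sum_finiteI)
next
  case (Suc k)
  have "((\<lambda>(j, js). B j * prod_list (map B js)) has_sum q * q ^ k) (A \<times> {js \<in> lists A. length js = k})"
    by (rule has_sum_mult_Times_nonneg[OF q Suc]) (auto intro!: prod_list_nonneg B)
  then show ?case by (intro has_sum_lists_Suc) simp
qed

lemma has_sum_lists_sum_list_prod_list:
  fixes B :: "nat \<Rightarrow> real"
  assumes q: "(B has_sum q) A" and \<mu>: "((\<lambda>j. real j * B j) has_sum \<mu>) A"
    and B: "\<And>j. 0 \<le> B j"
  shows "((\<lambda>js. real (sum_list js) * prod_list (map B js)) has_sum real k * \<mu> * q ^ (k - 1))
    {js \<in> lists A. length js = k}"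
proof (induction k)
  case 0
  have "{js \<in> lists A. length js = 0} = {[]}" by auto
  then show ?case by (simp add: has_sum_finiteI)
next
  case (Suc k)
  let ?L = "{js \<in> lists A. length js = k}"
  have "((\<lambda>(j, js). (real j * B j) * prod_list (map B js)) has_sum \<mu> * q ^ k) (A \<times> ?L)"
    by (rule has_sum_mult_Times_nonneg[OF \<mu> has_sum_lists_prod_list[OF q B]])
      (auto intro!: prod_list_nonneg mult_nonneg_nonneg B)
  moreover have "((\<lambda>(j, js). B j * (real (sum_list js) * prod_list (map B js)))
      has_sum q * (real k * \<mu> * q ^ (k - 1))) (A \<times> ?L)"
    by (rule has_sum_mult_Times_nonneg[OF q Suc])
      (auto intro!: prod_list_nonneg mult_nonneg_nonneg B)
  ultimately have sum: "((\<lambda>x. (case x of (j, js) \<Rightarrow> (real j * B j) * prod_list (map B js)) +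
      (case x of (j, js) \<Rightarrow> B j * (real (sum_list js) * prod_list (map B js))))
      has_sum \<mu> * q ^ k + q * (real k * \<mu> * q ^ (k - 1))) (A \<times> ?L)"
    by (rule has_sum_add)
  have eq: "\<mu> * q ^ k + q * (real k * \<mu> * q ^ (k - 1)) = real (Suc k) * \<mu> * q ^ (Suc k - 1)"
    by (cases k) (simp_all add: algebra_simps)
  show ?case
    by (rule has_sum_lists_Suc, rule has_sum_cong[THEN iffD1, OF _ sum[unfolded eq]])
      (auto simp: algebra_simps)
qed

text \<open>For an index tuple with \<open>k\<close> entries, replacing the coefficients in a term of the Volterra series
  one at a time changes \<open>k + 1\<close> factors, and each of these coefficients is moved in time by at most
  the sum of the entries. The weight collects these two losses; one is added to the sum
  because the displacement from \<open>t / N\<close> to \<open>u0\<close> affects the empty tuple too.\<close>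

definition list_weight :: "nat list \<Rightarrow> real" where
  "list_weight js = real (Suc (length js)) * real (Suc (sum_list js))"

text \<open>On the tuples with \<open>k\<close> entries the sum is \<open>(k + 1) * (q ^ k + k * \<mu> * q ^ (k - 1))\<close>. As a
  function of \<open>k\<close> this combines the coefficients of the first two derivatives of the geometric series,
  so it is summable because \<open>q < 1\<close>.\<close>

lemma list_weight_summable:
  fixes B :: "nat \<Rightarrow> real"
  assumes B: "\<And>j. 0 \<le> B j" and "(\<lambda>j. real j * B j) summable_on A"
    and q: "(B has_sum q) A" "q < 1"
  shows "(\<lambda>js. list_weight js * prod_list (map B js)) summable_on lists A"
proof -
  obtain \<mu> where \<mu>: "((\<lambda>j. real j * B j) has_sum \<mu>) A"
    using assms(2) by (auto simp: summable_on_def)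
  have "0 \<le> q" by (rule has_sum_nonneg[OF q(1) B])
  let ?L = "\<lambda>k. {js \<in> lists A. length js = k}"
  let ?s = "\<lambda>k. real (Suc k) * (q ^ k + real k * \<mu> * q ^ (k - 1))"
  have level: "((\<lambda>js. list_weight js * prod_list (map B js)) has_sum ?s k) (?L k)" for k
  proof -
    have "((\<lambda>js. real (Suc k) * (prod_list (map B js) + real (sum_list js) * prod_list (map B js)))
        has_sum ?s k) (?L k)"
      by (intro has_sum_cmult_right has_sum_add has_sum_lists_prod_list
          has_sum_lists_sum_list_prod_list q \<mu> B)
    then show ?thesis
      by (rule has_sum_cong[THEN iffD1, rotated]) (simp add: list_weight_def algebra_simps)
  qed
  have geom: "summable (\<lambda>k. 1 * x ^ k)" if "norm x < 1" for x :: real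
    using summable_geometric[OF that] by simp
  have geom1: "summable (\<lambda>k. diffs (\<lambda>_. 1) k * x ^ k)" if "norm x < 1" for x :: real
    using that geom by (rule termdiff_converges)
  have geom2: "summable (\<lambda>k. diffs (diffs (\<lambda>_. 1)) k * x ^ k)" if "norm x < 1" for x :: real
    using that geom1 by (rule termdiff_converges)
  have "summable (\<lambda>k. real (Suc k) * q ^ k)"
    using geom1[of q] \<open>0 \<le> q\<close> q(2) by (simp add: diffs_def)
  moreover have "summable (\<lambda>k. \<mu> * (real (Suc k) * real k * q ^ (k - 1)))"
    using geom2[of q] \<open>0 \<le> q\<close> q(2)
    by (intro summable_mult, subst summable_Suc_iff[symmetric]) (simp add: diffs_def mult_ac)
  ultimately have "summable ?s"
    by (rule summable_add[THEN summable_cong[THEN iffD1, rotated]]) (simp add: algebra_simps)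
  moreover have nonneg: "0 \<le> list_weight js * prod_list (map B js)" for js
    by (auto simp: list_weight_def intro!: mult_nonneg_nonneg prod_list_nonneg B)
  ultimately have "?s summable_on UNIV"
    by (intro summable_nonneg_imp_summable_on) (use has_sum_nonneg[OF level] in auto)
  then have "(\<lambda>(k, js). list_weight js * prod_list (map B js)) summable_on (SIGMA k:UNIV. ?L k)"
    by (intro summable_on_SigmaI[where g = ?s]) (use level nonneg in auto)
  moreover have lists_eq: "lists A = snd ` (SIGMA k:UNIV. ?L k)"
    and inj: "inj_on snd (SIGMA k:UNIV. ?L k)"
    by (auto simp: inj_on_def image_iff)
  ultimately show ?thesis
    by (subst lists_eq, subst summable_on_reindex[OF inj]) (simp add: comp_def case_prod_unfold)
qed

section \<open>Comparison of Volterra terms\<close>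

lemma volterra_term_const_one:
  "volterra_term (\<lambda>j _. B j) (\<lambda>_. 1) t js = B 0 * prod_list (map B js)"
  by (induction js arbitrary: t) (simp_all add: volterra_term_Cons)

lemma volterra_term_const_shift:
  "volterra_term (\<lambda>j _. B j) (\<lambda>s. z (s + t)) 0 js = volterra_term (\<lambda>j _. B j) z t js"
  by (simp add: volterra_term_def algebra_simps)

lemma volterra_term_nonneg:
  assumes "\<And>j s. s \<in> {t - int (sum_list js)..t} \<Longrightarrow> 0 \<le> b j s"
  shows "0 \<le> volterra_term b z t js"
  using assms
proof (induction js arbitrary: t)
  case (Cons j js)
  have "0 \<le> volterra_term b z (t - int j) js"
    by (rule Cons.IH) (use Cons.prems in auto)
  moreover have "0 \<le> b j t" by (rule Cons.prems) auto
  ultimately show ?case by (simp add: volterra_term_Cons)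
qed simp

lemma volterra_term_mono:
  assumes "\<And>j s. s \<in> {t - int (sum_list js)..t} \<Longrightarrow> 0 \<le> b j s \<and> b j s \<le> b' j s"
  shows "volterra_term b z t js \<le> volterra_term b' z t js"
  using assms
proof (induction js arbitrary: t)
  case (Cons j js)
  have "volterra_term b z (t - int j) js \<le> volterra_term b' z (t - int j) js"
    by (rule Cons.IH) (use Cons.prems in auto)
  moreover have "0 \<le> b j t" "b j t \<le> b' j t" using Cons.prems[of t j] by auto
  moreover have "0 \<le> volterra_term b z (t - int j) js"
    by (rule volterra_term_nonneg) (use Cons.prems in auto)
  ultimately show ?case by (auto simp: volterra_term_Cons intro!: mult_mono mult_left_mono)
qed (auto intro!: mult_right_mono)

text \<open>Telescoping: the two products are compared by exchanging one coefficient at a time, in an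
  induction along the tuple. Each of the \<open>Suc (length js)\<close> exchanges costs a factor \<open>e\<close> against the
  term in which all coefficients are replaced by their bounds. The hypotheses are confined to the times
  from \<open>t - sum_list js\<close> to \<open>t\<close>, because the bounds on \<open>a j (s / N)\<close> hold for \<open>0 \<le> s \<le> N\<close> only.\<close>

lemma volterra_term_diff_le:
  fixes B :: "nat \<Rightarrow> real"
  assumes "\<And>j s. s \<in> {t - int (sum_list js)..t} \<Longrightarrow>
      0 \<le> b j s \<and> b j s \<le> B j \<and> 0 \<le> b' j s \<and> b' j s \<le> B j \<and> \<bar>b j s - b' j s\<bar> \<le> e * B j"
    and "0 \<le> e"
  shows "\<bar>volterra_term b z t js - volterra_term b' z t js\<bar> \<le>
    e * real (Suc (length js)) * volterra_term (\<lambda>j _. B j) z t js"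
  using assms(1)
proof (induction js arbitrary: t)
  case Nil
  have "\<bar>b 0 t - b' 0 t\<bar> * (z t)\<^sup>2 \<le> e * B 0 * (z t)\<^sup>2"
    by (rule mult_right_mono) (use Nil[of t 0] in auto)
  then show ?case by (simp add: abs_mult mult_ac flip: left_diff_distrib)
next
  case (Cons j js)
  let ?v = "volterra_term b z (t - int j) js"
  let ?v' = "volterra_term b' z (t - int j) js"
  let ?V = "volterra_term (\<lambda>j _. B j) z (t - int j) js"
  let ?k = "real (Suc (length js))"
  have IH: "\<bar>?v - ?v'\<bar> \<le> e * ?k * ?V"
    by (rule Cons.IH) (use Cons.prems in auto)
  have v: "0 \<le> ?v" "?v \<le> ?V"
    by (rule volterra_term_nonneg volterra_term_mono; use Cons.prems in fastforce)+
  have bt: "\<bar>b j t - b' j t\<bar> \<le> e * B j" "0 \<le> b' j t" "b' j t \<le> B j"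
    using Cons.prems[of t j] by auto
  have "\<bar>b j t * ?v - b' j t * ?v'\<bar> = \<bar>(b j t - b' j t) * ?v + b' j t * (?v - ?v')\<bar>"
    by (simp add: algebra_simps)
  also have "\<dots> \<le> \<bar>b j t - b' j t\<bar> * ?v + b' j t * \<bar>?v - ?v'\<bar>"
    using v bt by (intro order_trans[OF abs_triangle_ineq]) (simp add: abs_mult)
  also have "\<dots> \<le> (e * B j) * ?V + B j * (e * ?k * ?V)"
    using v bt IH by (intro add_mono mult_mono) auto
  also have "\<dots> = e * (?k + 1) * (B j * ?V)"
    by (simp add: algebra_simps)
  finally have "(z t)\<^sup>2 * \<bar>b j t * ?v - b' j t * ?v'\<bar> \<le> (z t)\<^sup>2 * (e * (?k + 1) * (B j * ?V))"
    by (rule mult_left_mono) simp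
  moreover have "\<bar>volterra_term b z t (j # js) - volterra_term b' z t (j # js)\<bar> =
      (z t)\<^sup>2 * \<bar>b j t * ?v - b' j t * ?v'\<bar>"
    by (simp add: volterra_term_Cons mult.assoc abs_mult flip: right_diff_distrib)
  ultimately show ?case by (simp add: volterra_term_Cons algebra_simps)
qed

text \<open>Let \<open>\<delta>\<close> be the distance of \<open>t / N\<close> from \<open>u0\<close> and \<open>S\<close> the sum of the entries of the tuple. If
  \<open>S \<le> t\<close>, all coefficients of the time-varying term are taken at rescaled times in \<open>{0..1}\<close> within
  \<open>\<delta> + S / N\<close> of \<open>u0\<close>, and the Lipschitz condition applies to each. If \<open>S > t\<close>, the time-varying
  term vanishes because it reaches back to a negative time, and there is no smallness in the
  stationary term itself; but then \<open>u0 \<le> \<delta> + t / N \<le> \<delta> + S / N\<close>, so the constant factor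
  \<open>1 / u0\<close> suffices. This is why the constant depends on \<open>u0\<close>. Finally
  \<open>\<delta> + S / N \<le> (\<delta> + 1 / N) * (S + 1)\<close>.\<close>

lemma volterra_term_tv_diff_le:
  fixes B :: "nat \<Rightarrow> real" and t :: int and N :: nat
  assumes a: "\<And>j u. u \<in> {0..1} \<Longrightarrow> 0 \<le> a j u \<and> a j u \<le> B j"
    and lip: "\<And>j u v. u \<in> {0..1} \<Longrightarrow> v \<in> {0..1} \<Longrightarrow> \<bar>a j u - a j v\<bar> \<le> L * \<bar>u - v\<bar> * B j"
    and "0 \<le> L" and u0: "u0 \<in> {0<..1}" and N: "1 \<le> N" and t: "t \<in> {1..int N}"
  shows "\<bar>volterra_term (tv_coeff a N) z t js - volterra_term (\<lambda>j _. a j u0) z t js\<bar> \<le>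
    (L + 1 / u0) * (\<bar>real_of_int t / real N - u0\<bar> + 1 / real N) *
    (list_weight js * volterra_term (\<lambda>j _. B j) z t js)"
    (is "?d \<le> _")
proof -
  define \<delta> where "\<delta> = \<bar>real_of_int t / real N - u0\<bar>"
  define S where "S = real (sum_list js)"
  let ?k = "real (Suc (length js))"
  let ?V = "volterra_term (\<lambda>j _. B j) z t js"
  have u0': "0 < u0" "u0 \<in> {0..1}" using u0 by auto
  have B: "0 \<le> B j" for j using a[OF u0'(2), of j] by linarith
  have V: "0 \<le> ?V" by (rule volterra_term_nonneg) (rule B)
  have \<delta>: "0 \<le> \<delta>" and S: "0 \<le> S" by (auto simp: \<delta>_def S_def)
  have "?d \<le> (L + 1 / u0) * (\<delta> + S / real N) * ?k * ?V"
  proof (cases "int (sum_list js) \<le> t")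
    case True
    have "?d \<le> (L * (\<delta> + S / real N)) * ?k * ?V"
    proof (rule volterra_term_diff_le)
      fix j s assume s: "s \<in> {t - int (sum_list js)..t}"
      have coeff: "tv_coeff a N j s = a j (real_of_int s / real N)"
        using s True by (simp add: tv_coeff_def)
      have s01: "real_of_int s / real N \<in> {0..1}"
        using s t N True by (auto simp: divide_simps)
      have "\<bar>real_of_int s / real N - real_of_int t / real N\<bar> \<le> S / real N"
        using s unfolding S_def diff_divide_distrib[symmetric] abs_divide
        by (simp add: divide_right_mono)
      then have "\<bar>real_of_int s / real N - u0\<bar> \<le> \<delta> + S / real N"
        unfolding \<delta>_def by linarith
      then have "L * \<bar>real_of_int s / real N - u0\<bar> * B j \<le> L * (\<delta> + S / real N) * B j"
        using \<open>0 \<le> L\<close> B by (intro mult_right_mono mult_left_mono) auto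
      then show "0 \<le> tv_coeff a N j s \<and> tv_coeff a N j s \<le> B j \<and> 0 \<le> a j u0 \<and> a j u0 \<le> B j \<and>
          \<bar>tv_coeff a N j s - a j u0\<bar> \<le> L * (\<delta> + S / real N) * B j"
        unfolding coeff using a[OF s01] a[OF u0'(2)] lip[OF s01 u0'(2), of j] by auto
    qed (use \<open>0 \<le> L\<close> \<delta> S in auto)
    also have "\<dots> \<le> (L + 1 / u0) * (\<delta> + S / real N) * ?k * ?V"
      using V \<delta> S u0' by (intro mult_right_mono) auto
    finally show ?thesis .
  next
    case False
    have tv0: "volterra_term (tv_coeff a N) z t js = 0"
      using False by (simp add: volterra_term_def tv_coeff_def)
    have "0 \<le> volterra_term (\<lambda>j _. a j u0) z t js" "volterra_term (\<lambda>j _. a j u0) z t js \<le> ?V"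
      by (rule volterra_term_nonneg volterra_term_mono; use a[OF u0'(2)] in auto)+
    then have "?d \<le> ?V" by (simp add: tv0)
    also have "?V = 1 * 1 * ?V" by simp
    also have "\<dots> \<le> ((L + 1 / u0) * (\<delta> + S / real N)) * ?k * ?V"
    proof (intro mult_right_mono[OF mult_mono] V)
      have "real_of_int t \<le> S" using False by (simp add: S_def)
      then have "real_of_int t / real N \<le> S / real N" by (simp add: divide_right_mono)
      then have "u0 \<le> \<delta> + S / real N" unfolding \<delta>_def by linarith
      then have "1 \<le> 1 / u0 * (\<delta> + S / real N)" using u0' by (simp add: field_simps)
      also have "\<dots> \<le> (L + 1 / u0) * (\<delta> + S / real N)"
        using \<open>0 \<le> L\<close> \<delta> S by (intro mult_right_mono) auto
      finally show "1 \<le> (L + 1 / u0) * (\<delta> + S / real N)" .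
      then show "0 \<le> (L + 1 / u0) * (\<delta> + S / real N)" by linarith
    qed auto
    finally show ?thesis .
  qed
  also have "\<dots> \<le> (L + 1 / u0) * ((\<delta> + 1 / real N) * real (Suc (sum_list js))) * ?k * ?V"
  proof (intro mult_right_mono mult_left_mono V)
    show "\<delta> + S / real N \<le> (\<delta> + 1 / real N) * real (Suc (sum_list js))"
      using \<delta> S by (simp add: S_def algebra_simps)
  qed (use \<open>0 \<le> L\<close> u0' in auto)
  finally show ?thesis by (simp add: list_weight_def \<delta>_def mult_ac)
qed

section \<open>The majorant\<close>

text \<open>As the entries of the tuple are positive, the times \<open>t - (j\<^sub>1 + \<dots> + j\<^sub>r)\<close> are pairwise distinct.
  So the squared innovations in the term are independent with mean \<open>1\<close>, and integration amounts to
  setting all of them to \<open>1\<close>.\<close>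

lemma has_bochner_integral_volterra_term:
  assumes M: "prob_space M" and indep: "prob_space.indep_vars M (\<lambda>_. borel) Z UNIV"
    and Z2: "\<And>t. has_bochner_integral M (\<lambda>\<omega>. (Z t \<omega>)\<^sup>2) 1"
    and js: "js \<in> lists {1..}"
  shows "has_bochner_integral M (\<lambda>\<omega>. volterra_term b (\<lambda>s. Z s \<omega>) t js)
    (volterra_term b (\<lambda>_. 1) t js)"
proof -
  interpret prob_space M by (rule M)
  let ?p = "\<lambda>r. t - int (sum_list (take r js))"
  have lt: "sum_list (take r js) < sum_list (take r' js)" if "r < r'" "r' \<le> length js" for r r'
    using that
  proof (induction r' rule: less_Suc_induct)
    case (1 i)
    then have "js ! i \<in> {1..}" using js by (auto simp: in_lists_conv_set)
    then show ?case using 1 by (simp add: take_Suc_conv_app_nth)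
  qed auto
  \<comment> \<open>Partial sums of positive entries increase strictly.\<close>
  have inj: "inj_on ?p {..length js}"
  proof (rule inj_onI)
    fix r r' assume "r \<in> {..length js}" "r' \<in> {..length js}" "?p r = ?p r'"
    then show "r = r'" using lt[of r r'] lt[of r' r] by (cases r r' rule: linorder_cases) auto
  qed
  define S where "S = ?p ` {..length js}"
  have S: "finite S" by (simp add: S_def)
  have ind: "indep_vars (\<lambda>_. borel) (\<lambda>s \<omega>. (Z s \<omega>)\<^sup>2) S"
    by (rule indep_vars_compose2[where Y = "\<lambda>_ x. x\<^sup>2"], rule indep_vars_subset[OF indep]) auto
  have int: "integrable M (\<lambda>\<omega>. (Z s \<omega>)\<^sup>2)" "expectation (\<lambda>\<omega>. (Z s \<omega>)\<^sup>2) = 1" for s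
    using Z2[of s] by (auto simp: has_bochner_integral_iff)
  have "has_bochner_integral M (\<lambda>\<omega>. \<Prod>s\<in>S. (Z s \<omega>)\<^sup>2) 1"
    using indep_vars_integrable[OF S ind int(1)] indep_vars_lebesgue_integral[OF S ind int(1)]
    by (simp add: has_bochner_integral_iff int)
  then have "has_bochner_integral M (\<lambda>\<omega>. \<Prod>r\<le>length js. (Z (?p r) \<omega>)\<^sup>2) 1"
    unfolding S_def using inj by (simp add: prod.reindex)
  then show ?thesis
    unfolding volterra_term_def
    by (rule has_bochner_integral_mult_right[THEN has_bochner_integral_cong[THEN iffD1, rotated 3]]) auto
qed

text \<open>The process \<open>U\<close> of the theorem is \<open>majorant B\<close> evaluated along the shifted innovations. The series is
  written as an integral over the counting measure, which is measurable in \<open>z\<close> and takes the value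
  \<open>0\<close> where the series diverges. The summand \<open>1\<close> makes the majorant strictly positive.\<close>

definition majorant :: "(nat \<Rightarrow> real) \<Rightarrow> (int \<Rightarrow> real) \<Rightarrow> real" where
  "majorant B z = 1 + (\<integral>js. list_weight js * volterra_term (\<lambda>j _. B j) z 0 js \<partial>count_space (lists {1..}))"

lemma measurable_volterra_term [measurable]:
  "(\<lambda>z. volterra_term b z t js) \<in> borel_measurable (\<Pi>\<^sub>M t\<in>UNIV. borel)"
  unfolding volterra_term_def by measurable

lemma sigma_finite_count_space_lists: "sigma_finite_measure (count_space (lists A :: nat list set))"
  by (rule sigma_finite_measure_count_space_countable) (rule countableI_type)

lemma measurable_majorant: "majorant B \<in> borel_measurable (\<Pi>\<^sub>M t\<in>UNIV. borel)"
proof -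
  interpret sigma_finite_measure "count_space (lists {1..} :: nat list set)"
    by (rule sigma_finite_count_space_lists)
  let ?f = "\<lambda>(js, z). list_weight js * volterra_term (\<lambda>j _. B j) z 0 js"
  have "?f \<in> borel_measurable (count_space (lists {1..}) \<Otimes>\<^sub>M (\<Pi>\<^sub>M t\<in>UNIV. borel))"
    by (rule measurable_pair_measure_countable1) (auto intro: countableI_type)
  then have "(\<lambda>x. ?f (snd x, fst x)) \<in>
      borel_measurable ((\<Pi>\<^sub>M t\<in>UNIV. borel) \<Otimes>\<^sub>M count_space (lists {1..}))"
    by (rule measurable_compose[rotated]) simp
  then show ?thesis
    unfolding majorant_def
    by (intro borel_measurable_add borel_measurable_lebesgue_integral) (simp_all add: case_prod_unfold)
qed

lemma majorant_pos:
  assumes "\<And>j. 0 \<le> B j"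
  shows "0 < majorant B z"
proof -
  have "0 \<le> (\<integral>js. list_weight js * volterra_term (\<lambda>j _. B j) z 0 js \<partial>count_space (lists {1..}))"
    by (intro Bochner_Integration.integral_nonneg) (auto simp: list_weight_def intro!: mult_nonneg_nonneg volterra_term_nonneg assms)
  then show ?thesis by (simp add: majorant_def)
qed

text \<open>Fubini for the product of \<open>M\<close> with the counting measure on tuples: integrating a term of the series
  over \<open>M\<close> leaves \<open>B 0\<close> times its weighted coefficient product, and these are summable. Hence the
  series converges almost surely and its sum is integrable.\<close>

lemma integrable_majorant:
  fixes B :: "nat \<Rightarrow> real"
  assumes M: "prob_space M" and indep: "prob_space.indep_vars M (\<lambda>_. borel) Z UNIV"
    and Z2: "\<And>t. has_bochner_integral M (\<lambda>\<omega>. (Z t \<omega>)\<^sup>2) 1"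
    and B: "\<And>j. 0 \<le> B j"
    and sum: "(\<lambda>js. list_weight js * prod_list (map B js)) summable_on lists {1..}"
  shows "integrable M (\<lambda>\<omega>. majorant B (\<lambda>s. Z (s + t) \<omega>))"
    and "AE \<omega> in M. ((\<lambda>js. list_weight js * volterra_term (\<lambda>j _. B j) (\<lambda>s. Z s \<omega>) t js)
      has_sum (majorant B (\<lambda>s. Z (s + t) \<omega>) - 1)) (lists {1..})"
proof -
  interpret prob_space M by (rule M)
  let ?C = "count_space (lists {1..} :: nat list set)"
  interpret C: sigma_finite_measure ?C by (rule sigma_finite_count_space_lists)
  interpret pair_sigma_finite M ?C ..
  interpret CM: pair_sigma_finite ?C M ..
  let ?h = "\<lambda>(js, \<omega>). list_weight js * volterra_term (\<lambda>j _. B j) (\<lambda>s. Z s \<omega>) t js"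
  have nonneg: "0 \<le> list_weight js * volterra_term (\<lambda>j _. B j) z s js" for js z s
    by (auto simp: list_weight_def intro!: mult_nonneg_nonneg volterra_term_nonneg B)
  have hbi: "has_bochner_integral M (\<lambda>\<omega>. ?h (js, \<omega>)) (B 0 * (list_weight js * prod_list (map B js)))"
    if "js \<in> lists {1..}" for js
    using has_bochner_integral_mult_right[OF
        has_bochner_integral_volterra_term[OF M indep Z2 that, of "\<lambda>j _. B j" t], of "list_weight js"]
    by (simp add: volterra_term_const_one mult_ac)
  have "integrable ?C (\<lambda>js. list_weight js * prod_list (map B js))"
  proof -
    have "0 \<le> list_weight js * prod_list (map B js)" for js
      by (auto simp: list_weight_def intro!: mult_nonneg_nonneg prod_list_nonneg B)
    then have "(\<lambda>js. norm (list_weight js * prod_list (map B js))) summable_on lists {1..}"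
      using sum by simp
    from abs_summable_equivalent[THEN iffD1, OF this] show ?thesis
      unfolding abs_summable_on_def .
  qed
  then have int0: "integrable ?C (\<lambda>js. B 0 * (list_weight js * prod_list (map B js)))"
    by simp
  have "integrable (?C \<Otimes>\<^sub>M M) ?h"
  proof (rule CM.Fubini_integrable)
    show "?h \<in> borel_measurable (?C \<Otimes>\<^sub>M M)"
      by (rule measurable_pair_measure_countable1)
        (use hbi in \<open>auto intro: countableI_type borel_measurable_has_bochner_integral\<close>)
    have "(\<integral>\<omega>. norm (?h (js, \<omega>)) \<partial>M) = B 0 * (list_weight js * prod_list (map B js))"
      if "js \<in> lists {1..}" for js
      using has_bochner_integral_integral_eq[OF hbi[OF that]] nonneg by simp
    then show "integrable ?C (\<lambda>js. \<integral>\<omega>. norm (?h (js, \<omega>)) \<partial>M)"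
      by (intro Bochner_Integration.integrable_cong[THEN iffD1, OF refl _ int0]) simp
    show "AE js in ?C. integrable M (\<lambda>\<omega>. ?h (js, \<omega>))"
      using hbi by (intro AE_I2) (auto simp: has_bochner_integral_iff)
  qed
  then have prod: "integrable (M \<Otimes>\<^sub>M ?C) (\<lambda>(\<omega>, js). ?h (js, \<omega>))"
    by (rule CM.integrable_product_swap)
  have maj: "majorant B (\<lambda>s. Z (s + t) \<omega>) = 1 + (\<integral>js. ?h (js, \<omega>) \<partial>?C)" for \<omega>
    using volterra_term_const_shift[of B "\<lambda>s. Z s \<omega>" t] by (simp add: majorant_def)
  show "integrable M (\<lambda>\<omega>. majorant B (\<lambda>s. Z (s + t) \<omega>))"
    unfolding maj using integrable_fst'[OF prod] by (simp add: emeasure_space_1)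
  have "AE \<omega> in M. integrable ?C (\<lambda>js. ?h (js, \<omega>))"
    using AE_integrable_fst'[OF prod] by simp
  then show "AE \<omega> in M. ((\<lambda>js. list_weight js * volterra_term (\<lambda>j _. B j) (\<lambda>s. Z s \<omega>) t js)
      has_sum (majorant B (\<lambda>s. Z (s + t) \<omega>) - 1)) (lists {1..})"
  proof eventually_elim
    case (elim \<omega>)
    have abs: "integrable ?C f \<longleftrightarrow> (\<lambda>js. norm (f js)) summable_on lists {1..}" for f :: "nat list \<Rightarrow> real"
      using abs_summable_equivalent[unfolded abs_summable_on_def] by blast
    have "(\<integral>js. ?h (js, \<omega>) \<partial>?C) = infsum (\<lambda>js. ?h (js, \<omega>)) (lists {1..})"
      using infsetsum_infsum[unfolded abs_summable_on_def infsetsum_def, OF elim] .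
    moreover have "(\<lambda>js. ?h (js, \<omega>)) summable_on lists {1..}"
      using abs_summable_summable[OF abs[THEN iffD1, OF elim]] .
    ultimately show ?case
      by (simp add: maj has_sum_iff)
  qed
qed

section \<open>Approximation by the stationary process\<close>

theorem theorem1:
  fixes M :: "'w measure"
    and Z :: "int \<Rightarrow> 'w \<Rightarrow> real"
    and a :: "nat \<Rightarrow> real \<Rightarrow> real"
    and l :: "nat \<Rightarrow> real"
    and \<rho> Q C \<nu> :: real
    and X :: "nat \<Rightarrow> int \<Rightarrow> 'w \<Rightarrow> real"
    and Xs :: "real \<Rightarrow> int \<Rightarrow> 'w \<Rightarrow> real"
  assumes "prob_space M"
    and "iid_process M Z"
    and "\<And>t. has_bochner_integral M (Z t) 0"
    and "\<And>t. has_bochner_integral M (\<lambda>\<omega>. (Z t \<omega>)\<^sup>2) 1"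
    and "\<And>j u. u \<in> {0..1} \<Longrightarrow> 0 \<le> a j u"
    and "0 < \<rho>" and "0 < Q" and "0 < C" and "0 < \<nu>" and "\<nu> < 1"
    and "\<And>j. 0 < l j"
    and "summable (\<lambda>j. real (Suc j) / l (Suc j))"
    and "\<rho> < (INF u\<in>{0..1}. a 0 u)"
    and "\<And>j u. u \<in> {0..1} \<Longrightarrow> a j u \<le> Q / l j"
    and "\<And>j u v. u \<in> {0..1} \<Longrightarrow> v \<in> {0..1} \<Longrightarrow> \<bar>a j u - a j v\<bar> \<le> C * \<bar>u - v\<bar> / l j"
    and "Q * (\<Sum>j. 1 / l (Suc j)) \<le> 1 - \<nu>"
    and "\<And>N. 1 \<le> N \<Longrightarrow> tvARCH M Z a N (X N)"
    and "\<And>u. u \<in> {0<..1} \<Longrightarrow> stationary_ARCH M Z a u (Xs u)"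
  shows "\<exists>U :: int \<Rightarrow> 'w \<Rightarrow> real.
      stationary_process M U \<and> ergodic_process M U \<and>
      (\<forall>t. \<forall>\<omega>\<in>space M. 0 < U t \<omega>) \<and> (\<forall>t. integrable M (U t)) \<and>
      (\<forall>u0\<in>{0<..1}. \<exists>K :: real. \<forall>N\<ge>1. \<forall>t\<in>{1..int N}. AE \<omega> in M.
         \<bar>(X N t \<omega>)\<^sup>2 - (Xs u0 t \<omega>)\<^sup>2\<bar> \<le>
           K * (\<bar>real_of_int t / real N - u0\<bar> + 1 / real N) * U t \<omega>)"
proof -
  define B where "B j = Q / l j" for j
  have B: "0 \<le> B j" for j
    using assms(7,11) by (simp add: B_def less_imp_le)
  have indep: "prob_space.indep_vars M (\<lambda>_. borel) Z UNIV"
    using assms(2) by (simp add: iid_process_def)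
  have tail: "{1..} = range Suc"
    by (auto simp: image_iff) (metis Suc_le_D)
  have summable_l: "summable (\<lambda>j. 1 / l (Suc j))"
    by (rule summable_comparison_test_ev[OF _ assms(12)])
      (use assms(11) in \<open>auto simp: less_imp_le divide_right_mono\<close>)
  have "(\<lambda>j. Q * (real (Suc j) / l (Suc j))) summable_on UNIV"
    using assms(7,11,12) by (intro summable_nonneg_imp_summable_on summable_mult) (auto simp: less_imp_le)
  then have first_moment: "(\<lambda>j. real j * B j) summable_on {1..}"
    unfolding tail by (subst summable_on_reindex) (auto simp: B_def comp_def mult_ac)
  have "((\<lambda>j. Q * (1 / l (Suc j))) has_sum Q * (\<Sum>j. 1 / l (Suc j))) UNIV"
    using assms(7,11) by (intro sums_nonneg_imp_has_sum sums_mult summable_sums summable_l)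
      (auto simp: less_imp_le)
  then have mass: "(B has_sum Q * (\<Sum>j. 1 / l (Suc j))) {1..}"
    unfolding tail by (subst has_sum_reindex) (auto simp: B_def comp_def)
  have "Q * (\<Sum>j. 1 / l (Suc j)) < 1"
    using assms(9,16) by linarith
  note summable = list_weight_summable[OF B first_moment mass this]
  define U where "U t \<omega> = majorant B (\<lambda>s. Z (s + t) \<omega>)" for t \<omega>
  note majorant = integrable_majorant[OF assms(1) indep assms(4) B summable]
  have "stationary_process M U" "ergodic_process M U"
    unfolding U_def
    by (rule factor_of_iid_stationary_ergodic[OF assms(1,2) measurable_majorant])+
  moreover have "\<forall>t. \<forall>\<omega>\<in>space M. 0 < U t \<omega>"
    using majorant_pos[OF B] by (simp add: U_def)
  moreover have "\<forall>t. integrable M (U t)"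
    using majorant(1) by (simp add: U_def[abs_def])
  moreover have "\<exists>K :: real. \<forall>N\<ge>1. \<forall>t\<in>{1..int N}. AE \<omega> in M.
      \<bar>(X N t \<omega>)\<^sup>2 - (Xs u0 t \<omega>)\<^sup>2\<bar> \<le> K * (\<bar>real_of_int t / real N - u0\<bar> + 1 / real N) * U t \<omega>"
    if u0: "u0 \<in> {0<..1}" for u0
  proof (intro exI allI impI ballI)
    fix N :: nat and t :: int
    assume N: "1 \<le> N" and t: "t \<in> {1..int N}"
    let ?c = "(C / Q + 1 / u0) * (\<bar>real_of_int t / real N - u0\<bar> + 1 / real N)"
    have c: "0 \<le> ?c"
      using u0 assms(7,8) by (intro mult_nonneg_nonneg add_nonneg_nonneg) auto
    have tv: "AE \<omega> in M.
        (volterra_term (tv_coeff a N) (\<lambda>s. Z s \<omega>) t has_sum (X N t \<omega>)\<^sup>2) (lists {1..})"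
      using tvARCH_volterra[OF assms(17)[OF N]] t by simp
    have stat: "AE \<omega> in M.
        (volterra_term (\<lambda>j _. a j u0) (\<lambda>s. Z s \<omega>) t has_sum (Xs u0 t \<omega>)\<^sup>2) (lists {1..})"
      using assms(18)[OF u0] by (simp add: stationary_ARCH_def)
    have bounds: "0 \<le> a j u \<and> a j u \<le> B j" if "u \<in> {0..1}" for j u
      using assms(5,14)[OF that] by (simp add: B_def)
    have lip: "\<bar>a j u - a j v\<bar> \<le> C / Q * \<bar>u - v\<bar> * B j" if "u \<in> {0..1}" "v \<in> {0..1}" for j u v
      using assms(15)[OF that, of j] assms(7) by (simp add: B_def)
    have term_le: "\<bar>volterra_term (tv_coeff a N) z t js - volterra_term (\<lambda>j _. a j u0) z t js\<bar>
        \<le> ?c * (list_weight js * volterra_term (\<lambda>j _. B j) z t js)" for z js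
      by (rule volterra_term_tv_diff_le[OF bounds lip _ u0 N t]) (use assms(7,8) in auto)
    show "AE \<omega> in M. \<bar>(X N t \<omega>)\<^sup>2 - (Xs u0 t \<omega>)\<^sup>2\<bar> \<le> ?c * U t \<omega>"
      using tv stat majorant(2)[of t]
    proof eventually_elim
      case (elim \<omega>)
      have "((\<lambda>js. volterra_term (tv_coeff a N) (\<lambda>s. Z s \<omega>) t js -
          volterra_term (\<lambda>j _. a j u0) (\<lambda>s. Z s \<omega>) t js)
          has_sum (X N t \<omega>)\<^sup>2 - (Xs u0 t \<omega>)\<^sup>2) (lists {1..})"
        using has_sum_add[OF elim(1) has_sum_cmult_right[OF elim(2), of "-1"]] by simp
      from norm_infsum_le[OF this has_sum_cmult_right[OF elim(3), folded U_def]]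
      have "norm ((X N t \<omega>)\<^sup>2 - (Xs u0 t \<omega>)\<^sup>2) \<le> ?c * (U t \<omega> - 1)"
        using term_le by simp
      also have "\<dots> \<le> ?c * U t \<omega>"
        using c by (intro mult_left_mono) auto
      finally show ?case by simp
    qed
  qed
  ultimately show ?thesis by blast
qed

end
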